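(* Let $\{A_n\}_{n\ge 1}$ and $\{B_n\}_{n\ge 1}$ be sequences of $n\times n$ matrices having exponential decay with respect to common associated distance functions $d_n$, and assume that both sequences have a finite number of indices around each index (with respect to these $d_n$). For $\tau>0$ let $\tilde A_n,\tilde B_n$ be the truncated matrices $$[\tilde A_n]_{i,j}=\begin{cases}0,&\text{if }|[A_n]_{i,j}|<\tau,\\ [A_n]_{i,j},&\text{otherwise},\end{cases}\qquad [\tilde B_n]_{i,j}=\begin{cases}0,&\text{if }|[B_n]_{i,j}|<\tau,\\ [B_n]_{i,j},&\text{otherwise}.\end{cases}$$ Let $C_n=A_nB_n$, $\hat C_n=\mathrm{SpAMM}(\tilde A_n,\tilde B_n,\tau)$ and $E_n=C_n-\hat C_n$. Then: (1) for every fixed $n$, $|[E_n]_{i,j}|=O(\tau)$ as $\tau\to 0$, for all $i,j=1,\ldots,n$; (2) for every fixed $\tau>0$, $\|E_n\|_F=O(n^{1/2})$ as $n\to\infty$; (3) for every fixed $n$ and every $p<2$, $\|E_n\|_F=O(\tau^{p/2})$ as $\tau\to 0$.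
   Context: Matrices have real or complex entries; $\|\cdot\|_F$ is the Frobenius norm. Distance function: $d_n$ is a distance function on the index set $\{1,\ldots,n\}$ if for all indices $i,j,k$: $d_n(i,j)\ge 0$ (real valued); $d_n(i,j)=d_n(j,i)$; $d_n(i,i)=0$; $d_n(i,j)\le d_n(i,k)+d_n(k,j)$ (i.e. it is a pseudo-metric). For each $n$ one such $d_n$ is given. Exponential decay with respect to common associated distance functions: there exist positive constants $\alpha,c_1,c_2$, independent of $n$, such that for every $n$ and all $i,j=1,\ldots,n$, $$|[A_n]_{i,j}|\le c_1e^{-\alpha d_n(i,j)},\qquad |[B_n]_{i,j}|\le c_2e^{-\alpha d_n(i,j)}.$$ Finite number of indices around each index: there exist positive constants $\gamma,\beta$, independent of $n$, such that for every $n$, every $i=1,\ldots,n$ and every $R\ge 1$, $|N_{d_n}(i,R)|\le\gamma R^\beta$, where $N_{d_n}(i,R)=\{j\in\{1,\ldots,n\}: d_n(i,j)\le R\}$ is the set of indices within distance $R$ of $i$, and $|N_{d_n}(i,R)|$ is its cardinality. The SpAMM (sparse approximate matrix multiplication) algorithm: an $n\times n$ matrix is represented as a quad-tree of depth $\lceil\log_2 n\rceil$, padding with zero rows and columns at the end up to size $2^{\lceil\log_2 n\rceil}$ if $n$ is not a power of two; each matrix in the tree is split into four equally sized blocks $A=\begin{pmatrix} A_{0,0} & A_{0,1} \\ A_{1,0} & A_{1,1} \end{pmatrix}$, and the lowest level consists of single matrix elements. The product $C=\mathrm{SpAMM}(A,B,\tau)$ is defined recursively. At the lowest level (single elements), $\mathrm{SpAMM}(A,B,\tau)=AB$.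 Otherwise $C$ has blocks $C_{i,j}=T_0+T_1$ for $i,j\in\{0,1\}$, where for $k\in\{0,1\}$ $$T_k=\begin{cases}\mathrm{SpAMM}(A_{i,k},B_{k,j},\tau),&\text{if }\|A_{i,k}\|_F\|B_{k,j}\|_F\ge\tau,\\ 0,&\text{otherwise}.\end{cases}$$ (After padding, the result is restricted to the leading $n\times n$ block.) *)

theory Defs
  imports
    "Jordan_Normal_Form.Matrix"
    "HOL-Library.Landau_Symbols"
begin

text \<open>
  Indices run over \<open>0, \<dots>, n - 1\<close>, as in the matrix library, instead of \<open>1, \<dots>, n\<close>.
  Entries are taken from a type of class \<^class>\<open>real_normed_field\<close>, with \<^typ>\<open>real\<close> and
  \<^typ>\<open>complex\<close> as instances; up to isomorphism these are the only ones (Gelfand--Mazur).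
\<close>

definition frob_norm :: "'a::real_normed_field mat \<Rightarrow> real" where
  "frob_norm A = sqrt (\<Sum>i<dim_row A. \<Sum>j<dim_col A. (norm (A $$ (i, j)))\<^sup>2)"

definition distance_function :: "nat \<Rightarrow> (nat \<Rightarrow> nat \<Rightarrow> real) \<Rightarrow> bool" where
  "distance_function n d \<longleftrightarrow>
     (\<forall>i<n. \<forall>j<n. 0 \<le> d i j \<and> d i j = d j i) \<and>
     (\<forall>i<n. d i i = 0) \<and>
     (\<forall>i<n. \<forall>j<n. \<forall>k<n. d i j \<le> d i k + d k j)"

definition common_exp_decay ::
    "(nat \<Rightarrow> 'a::real_normed_field mat) \<Rightarrow> (nat \<Rightarrow> 'a mat) \<Rightarrow> (nat \<Rightarrow> nat \<Rightarrow> nat \<Rightarrow> real) \<Rightarrow> bool" where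
  "common_exp_decay A B d \<longleftrightarrow>
     (\<exists>\<alpha>>0. \<exists>c\<^sub>1>0. \<exists>c\<^sub>2>0. \<forall>n\<ge>1. \<forall>i<n. \<forall>j<n.
        norm (A n $$ (i, j)) \<le> c\<^sub>1 * exp (- \<alpha> * d n i j) \<and>
        norm (B n $$ (i, j)) \<le> c\<^sub>2 * exp (- \<alpha> * d n i j))"

definition nbhd :: "nat \<Rightarrow> (nat \<Rightarrow> nat \<Rightarrow> real) \<Rightarrow> nat \<Rightarrow> real \<Rightarrow> nat set" where
  "nbhd n d i R = {j. j < n \<and> d i j \<le> R}"

text \<open>The condition involves only the distance functions; it is therefore one and the same
  condition for all matrix sequences associated with \<open>d\<close>.\<close>

definition finite_indices :: "(nat \<Rightarrow> nat \<Rightarrow> nat \<Rightarrow> real) \<Rightarrow> bool" where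
  "finite_indices d \<longleftrightarrow>
     (\<exists>\<gamma>>0. \<exists>\<beta>>0. \<forall>n\<ge>1. \<forall>i<n. \<forall>R\<ge>1. real (card (nbhd n (d n) i R)) \<le> \<gamma> * R powr \<beta>)"

definition truncate_mat :: "real \<Rightarrow> 'a::real_normed_field mat \<Rightarrow> 'a mat" where
  "truncate_mat \<tau> A = map_mat (\<lambda>x. if norm x < \<tau> then 0 else x) A"

text \<open>The recursion on quad-trees: the second argument is the depth, the matrices at depth \<open>k\<close>
  have size \<open>2 ^ k\<close>.\<close>

primrec spamm_rec :: "real \<Rightarrow> nat \<Rightarrow> 'a::real_normed_field mat \<Rightarrow> 'a mat \<Rightarrow> 'a mat" where
  "spamm_rec \<tau> 0 A B = A * B"
| "spamm_rec \<tau> (Suc k) A B =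
     (let (A00, A01, A10, A11) = split_block A (2 ^ k) (2 ^ k);
          (B00, B01, B10, B11) = split_block B (2 ^ k) (2 ^ k);
          T = (\<lambda>X Y. if frob_norm X * frob_norm Y \<ge> \<tau> then spamm_rec \<tau> k X Y
                     else 0\<^sub>m (2 ^ k) (2 ^ k))
      in four_block_mat
           (T A00 B00 + T A01 B10) (T A00 B01 + T A01 B11)
           (T A10 B00 + T A11 B10) (T A10 B01 + T A11 B11))"

definition zero_pad :: "nat \<Rightarrow> 'a::zero mat \<Rightarrow> 'a mat" where
  "zero_pad m A =
     mat m m (\<lambda>(i, j). if i < dim_row A \<and> j < dim_col A then A $$ (i, j) else 0)"

text \<open>For \<open>n\<close> by \<open>n\<close> matrices with \<open>n \<ge> 1\<close>, where \<open>n\<close> is read off as the number of rows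
  of the first factor.\<close>

definition spamm :: "'a::real_normed_field mat \<Rightarrow> 'a mat \<Rightarrow> real \<Rightarrow> 'a mat" where
  "spamm A B \<tau> =
     (let n = dim_row A;
          k = nat \<lceil>log 2 (real n)\<rceil>;
          C = spamm_rec \<tau> k (zero_pad (2 ^ k) A) (zero_pad (2 ^ k) B)
      in mat n n (\<lambda>(i, j). C $$ (i, j)))"

definition spamm_error :: "'a::real_normed_field mat \<Rightarrow> 'a mat \<Rightarrow> real \<Rightarrow> 'a mat" where
  "spamm_error A B \<tau> = A * B - spamm (truncate_mat \<tau> A) (truncate_mat \<tau> B) \<tau>"

end

theory Submission
  imports
    Defs
    "HOL-Analysis.L2_Norm"
    "HOL-Real_Asymp.Real_Asymp"
begin

text \<open>
  Neither truncation nor SpAMM ever alters a summand of the inner product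
  \<open>C\<^sub>i\<^sub>j = (\<Sum>l. a\<^sub>i\<^sub>l b\<^sub>l\<^sub>j)\<close>: a summand is either kept exactly or dropped. Hence \<open>E\<^sub>i\<^sub>j\<close> is the sum of the
  dropped summands, and the three estimates come from bounding
  \<open>(\<Sum>l dropped. \<bar>a\<^sub>i\<^sub>l\<bar> \<bar>b\<^sub>l\<^sub>j\<bar>)\<close> in two ways.

  For fixed \<open>n\<close>, this sum is at most a constant times \<open>\<tau>\<close>. A dropped pair of blocks \<open>X, Y\<close> has
  \<open>\<parallel>X\<parallel> \<parallel>Y\<parallel> < \<tau>\<close>, which by Cauchy--Schwarz bounds its contribution to any single entry by \<open>\<tau>\<close>.
  Each level of the recursion adds the contributions of two block products, so the bound doubles
  per level (\<open>spamm_rec_partial_product\<close>), while a summand lost to truncation has a factor below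
  \<open>\<tau>\<close> and costs at most \<open>(\<bar>a\<^sub>i\<^sub>l\<bar> + \<bar>b\<^sub>l\<^sub>j\<bar>) \<tau>\<close> (\<open>partial_product_truncate\<close>). This gives the entrywise
  \<open>O(\<tau>)\<close>. As a matrix of fixed size has Frobenius norm at most the sum of its absolute entries, it
  also gives \<open>\<parallel>E\<^sub>n\<parallel> = O(\<tau>)\<close>, which is stronger than \<open>O(\<tau>\<^bsup>p/2\<^esup>)\<close> for every \<open>p < 2\<close>.

  For fixed \<open>\<tau>\<close> and growing \<open>n\<close>, it suffices to bound the dropped part by everything, so that
  \<open>\<bar>E\<bar> \<le> \<bar>A\<bar> \<bar>B\<bar>\<close> entrywise (\<open>spamm_error_entry_bounds\<close>). The decay, together with the polynomial
  growth of neighbourhoods, bounds the absolute row sums of \<open>A\<close> and \<open>B\<close> independently of \<open>n\<close>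
  (\<open>exp_row_sums_bounded\<close>), hence also those of \<open>\<bar>A\<bar> \<bar>B\<bar>\<close>. Thus every row of \<open>E\<close> has bounded Euclidean
  norm, and the \<open>n\<close> rows together have norm \<open>O(n\<^bsup>1/2\<^esup>)\<close>.
\<close>

section \<open>The Frobenius norm\<close>

lemma frob_norm_eq_L2_set:
  "frob_norm A = L2_set (\<lambda>ij. norm (A $$ ij)) ({..<dim_row A} \<times> {..<dim_col A})"
  by (simp add: frob_norm_def L2_set_def sum.cartesian_product)

lemma frob_norm_le_sum:
  "frob_norm A \<le> (\<Sum>i<dim_row A. \<Sum>j<dim_col A. norm (A $$ (i, j)))"
proof -
  have "frob_norm A \<le> (\<Sum>ij\<in>{..<dim_row A} \<times> {..<dim_col A}. norm (A $$ ij))"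
    unfolding frob_norm_eq_L2_set by (rule L2_set_le_sum) simp
  then show ?thesis
    by (simp add: sum.cartesian_product)
qed

lemma L2_set_row_le_frob_norm:
  assumes "i < dim_row A"
  shows "L2_set (\<lambda>l. norm (A $$ (i, l))) {..<dim_col A} \<le> frob_norm A"
proof -
  have "(\<Sum>l<dim_col A. (norm (A $$ (i, l)))\<^sup>2)
      \<le> (\<Sum>i<dim_row A. \<Sum>l<dim_col A. (norm (A $$ (i, l)))\<^sup>2)"
    using assms by (intro member_le_sum[where f = "\<lambda>i. \<Sum>l<dim_col A. (norm (A $$ (i, l)))\<^sup>2"])
      (auto intro: sum_nonneg)
  then show ?thesis
    by (simp add: L2_set_def frob_norm_def)
qed

lemma L2_set_col_le_frob_norm:
  assumes "j < dim_col A"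
  shows "L2_set (\<lambda>l. norm (A $$ (l, j))) {..<dim_row A} \<le> frob_norm A"
proof -
  have "(\<Sum>l<dim_row A. (norm (A $$ (l, j)))\<^sup>2)
      \<le> (\<Sum>l<dim_row A. \<Sum>j<dim_col A. (norm (A $$ (l, j)))\<^sup>2)"
    using assms by (intro sum_mono member_le_sum) auto
  then show ?thesis
    by (simp add: L2_set_def frob_norm_def)
qed

text \<open>
  Cauchy--Schwarz for row \<open>i\<close> of \<open>A\<close> and column \<open>j\<close> of \<open>B\<close>. It is what makes the test
  \<open>\<parallel>X\<parallel> \<parallel>Y\<parallel> \<ge> \<tau>\<close> meaningful for single entries.
\<close>

lemma sum_norm_products_le_frob_norm:
  fixes A B :: "'a::real_normed_field mat"
  assumes "A \<in> carrier_mat n m" "B \<in> carrier_mat m p" "i < n" "j < p"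
  shows "(\<Sum>l<m. norm (A $$ (i, l)) * norm (B $$ (l, j))) \<le> frob_norm A * frob_norm B"
proof -
  have "(\<Sum>l<m. norm (A $$ (i, l)) * norm (B $$ (l, j)))
      \<le> L2_set (\<lambda>l. norm (A $$ (i, l))) {..<m} * L2_set (\<lambda>l. norm (B $$ (l, j))) {..<m}"
    using L2_set_mult_ineq[of "\<lambda>l. norm (A $$ (i, l))" "\<lambda>l. norm (B $$ (l, j))" "{..<m}"] by simp
  also have "\<dots> \<le> frob_norm A * frob_norm B"
    using assms L2_set_row_le_frob_norm[of i A] L2_set_col_le_frob_norm[of j B]
    by (intro mult_mono) (auto simp: L2_set_nonneg frob_norm_eq_L2_set)
  finally show ?thesis .
qed

section \<open>SpAMM keeps some terms of each inner product\<close>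

text \<open>
  Here \<open>x\<close> stands for an approximation of \<open>(A * B)\<^sub>i\<^sub>j\<close> and \<open>S\<close> for the summands that it keeps.
  Measuring the loss by absolute values, rather than by the difference
  \<open>(A * B)\<^sub>i\<^sub>j - x\<close>, lets losses from different sources be added, and retaining the set \<open>S\<close> gives the
  bound by \<open>\<bar>A\<bar> \<bar>B\<bar>\<close> for free.
\<close>

definition partial_product ::
    "real \<Rightarrow> 'a::real_normed_field mat \<Rightarrow> 'a mat \<Rightarrow> nat \<Rightarrow> nat \<Rightarrow> 'a \<Rightarrow> bool" where
  "partial_product \<epsilon> A B i j x \<longleftrightarrow>
     (\<exists>S\<subseteq>{..<dim_row B}. x = (\<Sum>l\<in>S. A $$ (i, l) * B $$ (l, j)) \<and>
        (\<Sum>l\<in>{..<dim_row B} - S. norm (A $$ (i, l)) * norm (B $$ (l, j))) \<le> \<epsilon>)"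

lemma sum_split_halves:
  fixes h :: nat
  assumes "S \<subseteq> {..<h}" "T \<subseteq> {..<h}"
  shows "sum f (S \<union> (\<lambda>l. l + h) ` T) = sum f S + (\<Sum>l\<in>T. f (l + h))"
proof -
  have "finite S" "finite T"
    using assms finite_subset by blast+
  moreover have "S \<inter> (\<lambda>l. l + h) ` T = {}"
    using assms by auto
  ultimately show ?thesis
    by (subst sum.union_disjoint) (auto simp: sum.reindex)
qed

text \<open>
  The inner product of length \<open>2 * h\<close> splits into two of length \<open>h\<close>, as in
  \<open>C\<^sub>p\<^sub>q = A\<^sub>p\<^sub>0 B\<^sub>0\<^sub>q + A\<^sub>p\<^sub>1 B\<^sub>1\<^sub>q\<close>. Stating the hypotheses
  for a single row of \<open>A\<close> and a single column of \<open>B\<close> covers all four blocks \<open>C\<^sub>p\<^sub>q\<close> at once.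
\<close>

lemma partial_product_add_halves:
  assumes "dim_row B = 2 * h" "dim_row B0 = h" "dim_row B1 = h"
    and "\<And>l. l < h \<Longrightarrow> A0 $$ (i', l) = A $$ (i, l)"
    and "\<And>l. l < h \<Longrightarrow> A1 $$ (i', l) = A $$ (i, l + h)"
    and "\<And>l. l < h \<Longrightarrow> B0 $$ (l, j') = B $$ (l, j)"
    and "\<And>l. l < h \<Longrightarrow> B1 $$ (l, j') = B $$ (l + h, j)"
    and "partial_product \<epsilon> A0 B0 i' j' x" "partial_product \<delta> A1 B1 i' j' y"
  shows "partial_product (\<epsilon> + \<delta>) A B i j (x + y)"
proof -
  obtain S where S: "S \<subseteq> {..<h}" "x = (\<Sum>l\<in>S. A0 $$ (i', l) * B0 $$ (l, j'))"
      "(\<Sum>l\<in>{..<h} - S. norm (A0 $$ (i', l)) * norm (B0 $$ (l, j'))) \<le> \<epsilon>"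
    using assms by (auto simp: partial_product_def)
  obtain T where T: "T \<subseteq> {..<h}" "y = (\<Sum>l\<in>T. A1 $$ (i', l) * B1 $$ (l, j'))"
      "(\<Sum>l\<in>{..<h} - T. norm (A1 $$ (i', l)) * norm (B1 $$ (l, j'))) \<le> \<delta>"
    using assms by (auto simp: partial_product_def)
  \<comment> \<open>The summands of the second half are those with index shifted by \<open>h\<close>.\<close>
  let ?U = "S \<union> (\<lambda>l. l + h) ` T"
  have U: "?U \<subseteq> {..<2 * h}"
    using S(1) T(1) by auto
  have rest: "{..<2 * h} - ?U = ({..<h} - S) \<union> (\<lambda>l. l + h) ` ({..<h} - T)"
  proof (intro Set.set_eqI iffI)
    fix l assume "l \<in> {..<2 * h} - ?U"
    then show "l \<in> ({..<h} - S) \<union> (\<lambda>l. l + h) ` ({..<h} - T)"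
      by (cases "l < h") (auto simp: image_iff intro!: bexI[of _ "l - h"])
  next
    fix l assume "l \<in> ({..<h} - S) \<union> (\<lambda>l. l + h) ` ({..<h} - T)"
    then show "l \<in> {..<2 * h} - ?U"
      using S(1) T(1) by auto
  qed
  have x: "x = (\<Sum>l\<in>S. A $$ (i, l) * B $$ (l, j))"
    unfolding S(2) using S(1) assms(4,6) by (intro sum.cong) auto
  have y: "y = (\<Sum>l\<in>T. A $$ (i, l + h) * B $$ (l + h, j))"
    unfolding T(2) using T(1) assms(5,7) by (intro sum.cong) auto
  have "x + y = (\<Sum>l\<in>?U. A $$ (i, l) * B $$ (l, j))"
    unfolding x y by (simp add: sum_split_halves[OF S(1) T(1)])
  moreover have "(\<Sum>l\<in>{..<2 * h} - ?U. norm (A $$ (i, l)) * norm (B $$ (l, j))) \<le> \<epsilon> + \<delta>"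
    using S(3) T(3) assms(4-7) unfolding rest by (subst sum_split_halves) auto
  ultimately show ?thesis
    using U assms(1) unfolding partial_product_def by (intro exI[of _ ?U]) auto
qed

text \<open>
  The skipped block product: the value 0 leaves out every summand.
\<close>

lemma partial_product_empty:
  assumes "A \<in> carrier_mat n m" "B \<in> carrier_mat m p" "i < n" "j < p"
    and "frob_norm A * frob_norm B \<le> \<epsilon>"
  shows "partial_product \<epsilon> A B i j 0"
  using sum_norm_products_le_frob_norm[OF assms(1-4)] assms
  unfolding partial_product_def by (intro exI[of _ "{}"]) auto

lemma spamm_rec_carrier:
  assumes "A \<in> carrier_mat (2 ^ k) (2 ^ k)" "B \<in> carrier_mat (2 ^ k) (2 ^ k)"
  shows "spamm_rec \<tau> k A B \<in> carrier_mat (2 ^ k) (2 ^ k)"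
  using assms
proof (induction k arbitrary: A B)
  case (Suc k)
  let ?h = "2 ^ k :: nat"
  define T where "T = (\<lambda>X Y :: 'a mat. if frob_norm X * frob_norm Y \<ge> \<tau> then spamm_rec \<tau> k X Y
                     else 0\<^sub>m ?h ?h)"
  have T: "T X Y \<in> carrier_mat ?h ?h"
    if "X \<in> carrier_mat ?h ?h" "Y \<in> carrier_mat ?h ?h" for X Y
    using that by (simp add: T_def Suc.IH)
  obtain A00 A01 A10 A11 where A: "split_block A ?h ?h = (A00, A01, A10, A11)"
    by (cases "split_block A ?h ?h") auto
  obtain B00 B01 B10 B11 where B: "split_block B ?h ?h = (B00, B01, B10, B11)"
    by (cases "split_block B ?h ?h") auto
  have dims: "dim_row A = ?h + ?h" "dim_col A = ?h + ?h" "dim_row B = ?h + ?h" "dim_col B = ?h + ?h"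
    using Suc.prems by auto
  have "spamm_rec \<tau> (Suc k) A B = four_block_mat
           (T A00 B00 + T A01 B10) (T A00 B01 + T A01 B11)
           (T A10 B00 + T A11 B10) (T A10 B01 + T A11 B11)"
    by (simp add: A B T_def)
  also have "\<dots> \<in> carrier_mat (?h + ?h) (?h + ?h)"
    using split_block(1-4)[OF A dims(1,2)] split_block(1-4)[OF B dims(3,4)]
    by (intro four_block_carrier_mat add_carrier_mat T)
  finally show ?case
    by (simp add: mult_2)
qed auto

text \<open>
  The two block products that make up an entry each lose at most \<open>2 ^ k * \<tau>\<close>, either by the induction
  hypothesis or, if skipped, by the Frobenius test (when the loss is at most \<open>\<tau>\<close>). Together they
  lose at most \<open>2 ^ Suc k * \<tau>\<close>. At the leaves nothing is lost.
\<close>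

lemma spamm_rec_partial_product:
  assumes "\<tau> \<ge> 0"
    and "A \<in> carrier_mat (2 ^ k) (2 ^ k)" "B \<in> carrier_mat (2 ^ k) (2 ^ k)"
    and "i < 2 ^ k" "j < 2 ^ k"
  shows "partial_product (2 ^ k * \<tau>) A B i j (spamm_rec \<tau> k A B $$ (i, j))"
  using assms(2-)
proof (induction k arbitrary: A B i j)
  case 0
  then show ?case
    using assms(1) unfolding partial_product_def
    by (intro exI[of _ "{0}"]) (auto simp: scalar_prod_def lessThan_Suc)
next
  case (Suc k)
  let ?h = "2 ^ k :: nat"
  define T where "T = (\<lambda>X Y :: 'a mat. if frob_norm X * frob_norm Y \<ge> \<tau> then spamm_rec \<tau> k X Y
                     else 0\<^sub>m ?h ?h)"
  define blk where "blk = (\<lambda>(A :: 'a mat) p q. mat ?h ?h (\<lambda>(i, j). A $$ (i + p * ?h, j + q * ?h)))"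
  have blk: "blk M p q \<in> carrier_mat ?h ?h" for M p q
    by (simp add: blk_def)
  have T_carrier: "T X Y \<in> carrier_mat ?h ?h"
    if "X \<in> carrier_mat ?h ?h" "Y \<in> carrier_mat ?h ?h" for X Y
    using that by (simp add: T_def spamm_rec_carrier)
  have T: "partial_product (2 ^ k * \<tau>) X Y i j (T X Y $$ (i, j))"
    if "X \<in> carrier_mat ?h ?h" "Y \<in> carrier_mat ?h ?h" "i < ?h" "j < ?h" for X Y i j
  proof (cases "frob_norm X * frob_norm Y \<ge> \<tau>")
    case True
    with that Suc.IH show ?thesis
      by (simp add: T_def)
  next
    case False
    moreover have "\<tau> \<le> 2 ^ k * \<tau>"
      using mult_right_mono[of 1 "2 ^ k" \<tau>] assms(1) by simp
    ultimately show ?thesis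
      using that partial_product_empty[of X ?h ?h Y ?h i j "2 ^ k * \<tau>"] by (simp add: T_def)
  qed
  \<comment> \<open>Entry \<open>(i, j)\<close> lies in block \<open>(p, q)\<close>, at position \<open>(i', j')\<close> there. This treats the four
    blocks of the result uniformly.\<close>
  define p i' q j' where "p = i div ?h" "i' = i mod ?h" "q = j div ?h" "j' = j mod ?h"
  have i: "i = i' + p * ?h" "i' < ?h" "p < 2" and j: "j = j' + q * ?h" "j' < ?h" "q < 2"
    using Suc.prems unfolding p_i'_q_j'_def
    by (simp_all only: mod_mult_div_eq mod_div_mult_eq) (auto simp: less_mult_imp_div_less)
  have split: "split_block M ?h ?h = (blk M 0 0, blk M 0 1, blk M 1 0, blk M 1 1)"
    if "M \<in> carrier_mat (2 ^ Suc k) (2 ^ Suc k)" for M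
    using that by (auto simp: split_block_def Let_def blk_def intro!: eq_matI)
  have entry: "spamm_rec \<tau> (Suc k) A B $$ (i, j) =
      T (blk A p 0) (blk B 0 q) $$ (i', j') + T (blk A p 1) (blk B 1 q) $$ (i', j')"
  proof -
    have rec: "spamm_rec \<tau> (Suc k) A B = four_block_mat
           (T (blk A 0 0) (blk B 0 0) + T (blk A 0 1) (blk B 1 0))
           (T (blk A 0 0) (blk B 0 1) + T (blk A 0 1) (blk B 1 1))
           (T (blk A 1 0) (blk B 0 0) + T (blk A 1 1) (blk B 1 0))
           (T (blk A 1 0) (blk B 0 1) + T (blk A 1 1) (blk B 1 1))"
      by (simp add: split[OF Suc.prems(1)] split[OF Suc.prems(2)] T_def)
    have T_dims: "dim_row (T (blk M p q) (blk N r s)) = ?h" "dim_col (T (blk M p q) (blk N r s)) = ?h"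
      for M N p q r s
      using T_carrier[OF blk[of M p q] blk[of N r s]] by auto
    have "p = 0 \<or> p = 1" "q = 0 \<or> q = 1"
      using i j by auto
    then show ?thesis
      unfolding rec using i j by (auto simp: T_dims)
  qed
  have "partial_product (2 ^ k * \<tau> + 2 ^ k * \<tau>) A B i j (spamm_rec \<tau> (Suc k) A B $$ (i, j))"
    unfolding entry
    using T[OF blk[of A p 0] blk[of B 0 q] i(2) j(2)] T[OF blk[of A p 1] blk[of B 1 q] i(2) j(2)]
  proof (rule partial_product_add_halves[where h = ?h, rotated -2])
  qed (use Suc.prems i j in \<open>auto simp: blk_def\<close>)
  then show ?case
    by (simp add: algebra_simps)
qed

text \<open>
  Padding adds only zero summands, so the summands kept for the padded matrices may be
  restricted to indices below \<open>n\<close>.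
\<close>

lemma spamm_partial_product:
  assumes "n \<ge> 1" "\<tau> \<ge> 0" "A \<in> carrier_mat n n" "B \<in> carrier_mat n n" "i < n" "j < n"
  shows "partial_product (2 ^ nat \<lceil>log 2 (real n)\<rceil> * \<tau>) A B i j (spamm A B \<tau> $$ (i, j))"
proof -
  define k where "k = nat \<lceil>log 2 (real n)\<rceil>"
  have "log 2 (real n) \<le> real k"
    unfolding k_def by linarith
  then have "real n \<le> 2 powr real k"
    using assms(1) by (simp add: log_le_iff)
  also have "\<dots> = real (2 ^ k)"
    by (simp add: powr_realpow)
  finally have n_le: "n \<le> 2 ^ k"
    by (simp only: of_nat_le_iff)
  define A' B' where "A' = zero_pad (2 ^ k) A" "B' = zero_pad (2 ^ k) B"
  have carrier: "A' \<in> carrier_mat (2 ^ k) (2 ^ k)" "B' \<in> carrier_mat (2 ^ k) (2 ^ k)"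
    by (auto simp: A'_B'_def zero_pad_def)
  have "partial_product (2 ^ k * \<tau>) A' B' i j (spamm_rec \<tau> k A' B' $$ (i, j))"
    using assms n_le carrier by (intro spamm_rec_partial_product) auto
  moreover have "spamm_rec \<tau> k A' B' $$ (i, j) = spamm A B \<tau> $$ (i, j)"
    using assms by (simp add: spamm_def Let_def A'_B'_def k_def)
  ultimately obtain S where S: "S \<subseteq> {..<2 ^ k}"
      "spamm A B \<tau> $$ (i, j) = (\<Sum>l\<in>S. A' $$ (i, l) * B' $$ (l, j))"
      "(\<Sum>l\<in>{..<2 ^ k} - S. norm (A' $$ (i, l)) * norm (B' $$ (l, j))) \<le> 2 ^ k * \<tau>"
    using carrier by (auto simp: partial_product_def)
  have A': "A' $$ (i, l) = (if l < n then A $$ (i, l) else 0)" if "l < 2 ^ k" for l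
    using that assms n_le by (simp add: A'_B'_def zero_pad_def)
  have B': "B' $$ (l, j) = (if l < n then B $$ (l, j) else 0)" if "l < 2 ^ k" for l
    using that assms n_le by (simp add: A'_B'_def zero_pad_def)
  have "finite S" and less: "\<And>l. l \<in> S \<Longrightarrow> l < 2 ^ k"
    using S(1) finite_subset by blast+
  then have "(\<Sum>l\<in>S. A' $$ (i, l) * B' $$ (l, j)) = (\<Sum>l\<in>S \<inter> {..<n}. A $$ (i, l) * B $$ (l, j))"
    by (intro sum.mono_neutral_cong_right) (auto simp: A'[OF less] B'[OF less])
  moreover have "(\<Sum>l\<in>{..<n} - S \<inter> {..<n}. norm (A $$ (i, l)) * norm (B $$ (l, j)))
      = (\<Sum>l\<in>{..<2 ^ k} - S. norm (A' $$ (i, l)) * norm (B' $$ (l, j)))"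
    using n_le by (intro sum.mono_neutral_cong_left) (auto simp: A' B')
  ultimately show ?thesis
    using S(2,3) assms unfolding partial_product_def k_def[symmetric]
    by (intro exI[of _ "S \<inter> {..<n}"]) auto
qed

section \<open>The entries of the error matrix\<close>

lemma spamm_error_carrier:
  assumes "A \<in> carrier_mat n n" "B \<in> carrier_mat n n"
  shows "spamm_error A B \<tau> \<in> carrier_mat n n"
  using assms by (auto simp: spamm_error_def spamm_def truncate_mat_def Let_def)

text \<open>
  A summand survives both truncation and SpAMM iff it was kept by SpAMM and both its factors are
  at least \<open>\<tau>\<close> in norm. Otherwise one factor is below \<open>\<tau>\<close>, or the summand is already accounted
  for in \<open>\<epsilon>\<close>.
\<close>

lemma partial_product_truncate:
  fixes A B :: "'a::real_normed_field mat"
  assumes "\<tau> \<ge> 0" "A \<in> carrier_mat n n" "B \<in> carrier_mat n n" "i < n" "j < n"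
    and "partial_product \<epsilon> (truncate_mat \<tau> A) (truncate_mat \<tau> B) i j x"
  shows "partial_product (\<epsilon> + (\<Sum>l<n. norm (A $$ (i, l)) + norm (B $$ (l, j))) * \<tau>) A B i j x"
proof -
  let ?a = "\<lambda>l. A $$ (i, l)" and ?b = "\<lambda>l. B $$ (l, j)"
  let ?a' = "\<lambda>l. if norm (?a l) < \<tau> then 0 else ?a l"
  let ?b' = "\<lambda>l. if norm (?b l) < \<tau> then 0 else ?b l"
  have trunc: "truncate_mat \<tau> A $$ (i, l) = ?a' l" "truncate_mat \<tau> B $$ (l, j) = ?b' l"
    if "l < n" for l
    using that assms by (auto simp: truncate_mat_def)
  have "dim_row (truncate_mat \<tau> B) = n"
    using assms by (simp add: truncate_mat_def)
  then obtain S where S: "S \<subseteq> {..<n}"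
      "x = (\<Sum>l\<in>S. truncate_mat \<tau> A $$ (i, l) * truncate_mat \<tau> B $$ (l, j))"
      "(\<Sum>l\<in>{..<n} - S. norm (truncate_mat \<tau> A $$ (i, l)) * norm (truncate_mat \<tau> B $$ (l, j))) \<le> \<epsilon>"
    using assms(6) by (auto simp: partial_product_def)
  define large where "large = {l. \<tau> \<le> norm (?a l) \<and> \<tau> \<le> norm (?b l)}"
  have fin: "finite S" and less: "\<And>l. l \<in> S \<Longrightarrow> l < n"
    using S(1) finite_subset by blast+
  have x: "x = (\<Sum>l\<in>S \<inter> large. ?a l * ?b l)"
    unfolding S(2) using fin trunc[OF less]
    by (intro sum.mono_neutral_cong_right) (auto simp: large_def)
  have small: "norm (?a l) * norm (?b l) \<le> (norm (?a l) + norm (?b l)) * \<tau>"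
    if "l \<notin> large" for l
  proof (cases "norm (?a l) < \<tau>")
    case True
    then have "norm (?a l) * norm (?b l) \<le> \<tau> * norm (?b l)"
      by (intro mult_right_mono) auto
    also have "\<dots> \<le> (norm (?a l) + norm (?b l)) * \<tau>"
      using assms(1) by (simp add: distrib_right mult.commute[of \<tau>])
    finally show ?thesis .
  next
    case False
    with that have "norm (?a l) * norm (?b l) \<le> norm (?a l) * \<tau>"
      by (intro mult_left_mono) (auto simp: large_def)
    also have "\<dots> \<le> (norm (?a l) + norm (?b l)) * \<tau>"
      using assms(1) by (simp add: distrib_right)
    finally show ?thesis .
  qed
  have "(\<Sum>l\<in>{..<n} - S \<inter> large. norm (?a l) * norm (?b l))
      = (\<Sum>l\<in>({..<n} - S) \<inter> large. norm (?a l) * norm (?b l))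
        + (\<Sum>l\<in>{..<n} - large. norm (?a l) * norm (?b l))"
    by (subst sum.union_disjoint[symmetric]) (auto intro!: sum.cong)
  also have "(\<Sum>l\<in>({..<n} - S) \<inter> large. norm (?a l) * norm (?b l)) =
      (\<Sum>l\<in>{..<n} - S. norm (truncate_mat \<tau> A $$ (i, l)) * norm (truncate_mat \<tau> B $$ (l, j)))"
    by (intro sum.mono_neutral_cong_left) (auto simp: trunc large_def)
  also have "\<dots> \<le> \<epsilon>"
    by (rule S(3))
  also have "(\<Sum>l\<in>{..<n} - large. norm (?a l) * norm (?b l))
      \<le> (\<Sum>l\<in>{..<n} - large. (norm (?a l) + norm (?b l)) * \<tau>)"
    by (intro sum_mono small) auto
  also have "\<dots> \<le> (\<Sum>l<n. (norm (?a l) + norm (?b l)) * \<tau>)"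
    using assms(1) by (intro sum_mono2) auto
  finally show ?thesis
    using x S(1) assms(3) unfolding partial_product_def
    by (intro exI[of _ "S \<inter> large"]) (auto simp: sum_distrib_right)
qed

text \<open>
  The error entry is the sum of the lost summands. The first bound is small for fixed \<open>n\<close> and
  \<open>\<tau> \<rightarrow> 0\<close>; the second is independent of \<open>\<tau>\<close> and serves for growing \<open>n\<close>.
\<close>

lemma spamm_error_entry_bounds:
  assumes "n \<ge> 1" "\<tau> \<ge> 0" "A \<in> carrier_mat n n" "B \<in> carrier_mat n n" "i < n" "j < n"
  shows "norm (spamm_error A B \<tau> $$ (i, j))
           \<le> (2 ^ nat \<lceil>log 2 (real n)\<rceil> + (\<Sum>l<n. norm (A $$ (i, l)) + norm (B $$ (l, j)))) * \<tau>"
    and "norm (spamm_error A B \<tau> $$ (i, j)) \<le> (\<Sum>l<n. norm (A $$ (i, l)) * norm (B $$ (l, j)))"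
proof -
  let ?C = "spamm (truncate_mat \<tau> A) (truncate_mat \<tau> B) \<tau>"
  let ?ab = "\<lambda>l. A $$ (i, l) * B $$ (l, j)"
  have "partial_product (2 ^ nat \<lceil>log 2 (real n)\<rceil> * \<tau>
      + (\<Sum>l<n. norm (A $$ (i, l)) + norm (B $$ (l, j))) * \<tau>) A B i j (?C $$ (i, j))"
    using assms by (intro partial_product_truncate spamm_partial_product) (auto simp: truncate_mat_def)
  then obtain S where S: "S \<subseteq> {..<n}" "?C $$ (i, j) = sum ?ab S"
      "(\<Sum>l\<in>{..<n} - S. norm (A $$ (i, l)) * norm (B $$ (l, j)))
        \<le> (2 ^ nat \<lceil>log 2 (real n)\<rceil> + (\<Sum>l<n. norm (A $$ (i, l)) + norm (B $$ (l, j)))) * \<tau>"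
    using assms by (auto simp: partial_product_def distrib_right)
  have "spamm_error A B \<tau> $$ (i, j) = sum ?ab {..<n} - sum ?ab S"
    using assms unfolding S(2)[symmetric]
    by (auto simp: spamm_error_def spamm_def truncate_mat_def Let_def scalar_prod_def atLeast0LessThan)
  also have "\<dots> = sum ?ab ({..<n} - S)"
    using S(1) by (simp add: sum_diff)
  finally have "norm (spamm_error A B \<tau> $$ (i, j))
      \<le> (\<Sum>l\<in>{..<n} - S. norm (A $$ (i, l)) * norm (B $$ (l, j)))"
    by (simp add: sum_norm_le norm_mult)
  moreover from this have "norm (spamm_error A B \<tau> $$ (i, j))
      \<le> (\<Sum>l<n. norm (A $$ (i, l)) * norm (B $$ (l, j)))"
    by (rule order_trans) (auto intro!: sum_mono2)
  ultimately show "norm (spamm_error A B \<tau> $$ (i, j))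
           \<le> (2 ^ nat \<lceil>log 2 (real n)\<rceil> + (\<Sum>l<n. norm (A $$ (i, l)) + norm (B $$ (l, j)))) * \<tau>"
    and "norm (spamm_error A B \<tau> $$ (i, j)) \<le> (\<Sum>l<n. norm (A $$ (i, l)) * norm (B $$ (l, j)))"
    using S(3) by auto
qed

section \<open>Rows of exponentially decaying matrices\<close>

lemma summable_powr_times_exp:
  assumes "\<alpha> > 0"
  shows "summable (\<lambda>m. (real m + 1) powr \<beta> * exp (- \<alpha> * real m))"
proof (rule summable_comparison_test_bigo)
  \<comment> \<open>Half of the exponential decay absorbs the polynomial factor.\<close>
  show "summable (\<lambda>m. norm (exp (- \<alpha> / 2) ^ m))"
    using assms by (simp add: summable_geometric)
  have "(\<lambda>m. (real m + 1) powr \<beta> * exp (- \<alpha> * real m)) \<in> O(\<lambda>m. exp (real m * (- \<alpha> / 2)))"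
    using assms by real_asymp
  then show "(\<lambda>m. (real m + 1) powr \<beta> * exp (- \<alpha> * real m)) \<in> O(\<lambda>m. exp (- \<alpha> / 2) ^ m)"
    by (simp only: exp_of_nat_mult)
qed

text \<open>
  Sort the indices \<open>j\<close> into shells \<open>m \<le> d i j < m + 1\<close>. Shell \<open>m\<close> lies in the neighbourhood of radius
  \<open>m + 1\<close>, so it has at most \<open>\<gamma> * (m + 1) powr \<beta>\<close> elements, each contributing at most
  \<open>exp (- \<alpha> * m)\<close>; the resulting series converges and depends neither on \<open>n\<close> nor on \<open>i\<close>.
\<close>

lemma exp_row_sums_bounded:
  assumes "\<alpha> > 0" "finite_indices d" "\<And>n. n \<ge> 1 \<Longrightarrow> distance_function n (d n)"
  obtains K where "\<And>n i. n \<ge> 1 \<Longrightarrow> i < n \<Longrightarrow> (\<Sum>j<n. exp (- \<alpha> * d n i j)) \<le> K"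
proof -
  obtain \<gamma> \<beta> where "\<gamma> > 0"
    and card: "\<And>n i R. n \<ge> 1 \<Longrightarrow> i < n \<Longrightarrow> R \<ge> 1 \<Longrightarrow> real (card (nbhd n (d n) i R)) \<le> \<gamma> * R powr \<beta>"
    using assms(2) unfolding finite_indices_def by blast
  define f where "f = (\<lambda>m. \<gamma> * ((real m + 1) powr \<beta> * exp (- \<alpha> * real m)))"
  have summable: "summable f"
    unfolding f_def using assms(1) by (intro summable_mult summable_powr_times_exp)
  have "(\<Sum>j<n. exp (- \<alpha> * d n i j)) \<le> suminf f" if "n \<ge> 1" "i < n" for n i
  proof -
    define shell where "shell = (\<lambda>j. nat \<lfloor>d n i j\<rfloor>)"
    have d_nonneg: "0 \<le> d n i j" if "j < n" for j
      using assms(3)[OF \<open>n \<ge> 1\<close>] \<open>i < n\<close> that by (auto simp: distance_function_def)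
    have shell: "real (shell j) \<le> d n i j" "d n i j \<le> real (shell j) + 1" if "j < n" for j
      using d_nonneg[OF that] unfolding shell_def by linarith+
    have "(\<Sum>j\<in>{j \<in> {..<n}. shell j = m}. exp (- \<alpha> * d n i j)) \<le> f m" for m
    proof -
      have "(\<Sum>j\<in>{j \<in> {..<n}. shell j = m}. exp (- \<alpha> * d n i j))
          \<le> real (card {j \<in> {..<n}. shell j = m}) * exp (- \<alpha> * real m)"
        using assms(1) shell(1) by (intro sum_bounded_above) auto
      also have "card {j \<in> {..<n}. shell j = m} \<le> card (nbhd n (d n) i (real m + 1))"
        using shell(2) by (intro card_mono) (auto simp: nbhd_def)
      also have "real (card (nbhd n (d n) i (real m + 1))) \<le> \<gamma> * (real m + 1) powr \<beta>"
        using that by (intro card) auto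
      finally show ?thesis
        by (simp add: f_def mult.assoc)
    qed
    then have "(\<Sum>m\<in>shell ` {..<n}. \<Sum>j\<in>{j \<in> {..<n}. shell j = m}. exp (- \<alpha> * d n i j))
        \<le> sum f (shell ` {..<n})"
      by (intro sum_mono)
    also have "\<dots> \<le> suminf f"
      using \<open>\<gamma> > 0\<close> by (intro sum_le_suminf summable) (auto simp: f_def)
    finally show ?thesis
      by (subst (asm) sum.group) auto
  qed
  then show ?thesis
    by (rule that)
qed

section \<open>The asymptotic bounds\<close>

text \<open>
  The Euclidean norm of a row is at most the sum of its absolute entries.
\<close>

lemma frob_norm_le_of_row_sums:
  assumes "A \<in> carrier_mat n m" "K \<ge> 0" "\<And>i. i < n \<Longrightarrow> (\<Sum>j<m. norm (A $$ (i, j))) \<le> K"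
  shows "frob_norm A \<le> K * sqrt (real n)"
proof -
  have "(\<Sum>j<m. (norm (A $$ (i, j)))\<^sup>2) \<le> K\<^sup>2" if "i < n" for i
  proof -
    have "L2_set (\<lambda>j. norm (A $$ (i, j))) {..<m} \<le> K"
      using L2_set_le_sum[of "{..<m}" "\<lambda>j. norm (A $$ (i, j))"] assms(3)[OF that] by simp
    then show ?thesis
      by (simp add: L2_set_def sqrt_le_D)
  qed
  then have "(\<Sum>i<n. \<Sum>j<m. (norm (A $$ (i, j)))\<^sup>2) \<le> real n * K\<^sup>2"
    using sum_bounded_above[of "{..<n}" "\<lambda>i. \<Sum>j<m. (norm (A $$ (i, j)))\<^sup>2" "K\<^sup>2"] by simp
  then have "frob_norm A \<le> sqrt (real n * K\<^sup>2)"
    using assms(1) by (simp add: frob_norm_def)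
  then show ?thesis
    using assms(2) by (simp add: real_sqrt_mult mult.commute)
qed

text \<open>
  Submultiplicativity of the maximal absolute row sum.
\<close>

lemma sum_norm_products_le_of_row_sums:
  fixes A B :: "'a::real_normed_field mat"
  assumes "\<And>i. i < n \<Longrightarrow> (\<Sum>l<n. norm (A $$ (i, l))) \<le> K"
    and "\<And>l. l < n \<Longrightarrow> (\<Sum>j<n. norm (B $$ (l, j))) \<le> L"
    and "L \<ge> 0" "i < n"
  shows "(\<Sum>j<n. \<Sum>l<n. norm (A $$ (i, l)) * norm (B $$ (l, j))) \<le> K * L"
proof -
  have "(\<Sum>j<n. \<Sum>l<n. norm (A $$ (i, l)) * norm (B $$ (l, j)))
      = (\<Sum>l<n. norm (A $$ (i, l)) * (\<Sum>j<n. norm (B $$ (l, j))))"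
    by (subst sum.swap) (simp add: sum_distrib_left)
  also have "\<dots> \<le> (\<Sum>l<n. norm (A $$ (i, l)) * L)"
    using assms(2) by (intro sum_mono mult_left_mono) auto
  also have "\<dots> = (\<Sum>l<n. norm (A $$ (i, l))) * L"
    by (simp add: sum_distrib_right)
  also have "\<dots> \<le> K * L"
    using assms by (intro mult_right_mono) auto
  finally show ?thesis .
qed

lemma spamm_error_entry_bigo:
  assumes "n \<ge> 1" "A \<in> carrier_mat n n" "B \<in> carrier_mat n n" "i < n" "j < n"
  shows "(\<lambda>\<tau>. norm (spamm_error A B \<tau> $$ (i, j))) \<in> O[at_right 0](\<lambda>\<tau>. \<tau>)"
proof (rule bigoI)
  show "\<forall>\<^sub>F \<tau> in at_right 0. norm (norm (spamm_error A B \<tau> $$ (i, j)))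
      \<le> (2 ^ nat \<lceil>log 2 (real n)\<rceil> + (\<Sum>l<n. norm (A $$ (i, l)) + norm (B $$ (l, j)))) * norm \<tau>"
    using eventually_at_right_less
  proof eventually_elim
    case (elim \<tau>)
    then show ?case
      using spamm_error_entry_bounds(1)[OF assms(1) _ assms(2-), of \<tau>] by simp
  qed
qed

lemma frob_norm_spamm_error_bigo:
  assumes "n \<ge> 1" "A \<in> carrier_mat n n" "B \<in> carrier_mat n n"
  shows "(\<lambda>\<tau>. frob_norm (spamm_error A B \<tau>)) \<in> O[at_right 0](\<lambda>\<tau>. \<tau>)"
proof (rule landau_o.big_trans)
  show "(\<lambda>\<tau>. frob_norm (spamm_error A B \<tau>))
      \<in> O[at_right 0](\<lambda>\<tau>. \<Sum>i<n. \<Sum>j<n. norm (spamm_error A B \<tau> $$ (i, j)))"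
  proof (rule bigoI[of _ 1], rule always_eventually, rule allI)
    fix \<tau>
    have "spamm_error A B \<tau> \<in> carrier_mat n n"
      using assms by (intro spamm_error_carrier)
    then show "norm (frob_norm (spamm_error A B \<tau>))
        \<le> 1 * norm (\<Sum>i<n. \<Sum>j<n. norm (spamm_error A B \<tau> $$ (i, j)))"
      using frob_norm_le_sum[of "spamm_error A B \<tau>"]
      by (simp add: frob_norm_eq_L2_set L2_set_nonneg sum_nonneg)
  qed
  show "(\<lambda>\<tau>. \<Sum>i<n. \<Sum>j<n. norm (spamm_error A B \<tau> $$ (i, j))) \<in> O[at_right 0](\<lambda>\<tau>. \<tau>)"
    using assms by (intro big_sum_in_bigo spamm_error_entry_bigo) auto
qed

theorem theorem3p7:
  fixes A B :: "nat \<Rightarrow> 'a::real_normed_field mat"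
    and d :: "nat \<Rightarrow> nat \<Rightarrow> nat \<Rightarrow> real"
  assumes "\<And>n. n \<ge> 1 \<Longrightarrow> A n \<in> carrier_mat n n"
    and "\<And>n. n \<ge> 1 \<Longrightarrow> B n \<in> carrier_mat n n"
    and "\<And>n. n \<ge> 1 \<Longrightarrow> distance_function n (d n)"
    and "common_exp_decay A B d"
    and "finite_indices d"
  shows "(\<forall>n\<ge>1. \<forall>i<n. \<forall>j<n.
            (\<lambda>\<tau>. norm (spamm_error (A n) (B n) \<tau> $$ (i, j))) \<in> O[at_right 0](\<lambda>\<tau>. \<tau>))
       \<and> (\<forall>\<tau>>0. (\<lambda>n. frob_norm (spamm_error (A n) (B n) \<tau>)) \<in> O[at_top](\<lambda>n. real n powr (1 / 2)))
       \<and> (\<forall>n\<ge>1. \<forall>p<2.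
            (\<lambda>\<tau>. frob_norm (spamm_error (A n) (B n) \<tau>)) \<in> O[at_right 0](\<lambda>\<tau>. \<tau> powr (p / 2)))"
proof (intro conjI allI impI)
  fix n i j :: nat
  assume "n \<ge> 1" "i < n" "j < n"
  then show "(\<lambda>\<tau>. norm (spamm_error (A n) (B n) \<tau> $$ (i, j))) \<in> O[at_right 0](\<lambda>\<tau>. \<tau>)"
    using assms by (intro spamm_error_entry_bigo) auto
next
  fix \<tau> :: real
  assume "\<tau> > 0"
  obtain \<alpha> c\<^sub>1 c\<^sub>2 where pos: "\<alpha> > 0" "c\<^sub>1 > 0" "c\<^sub>2 > 0"
    and decay: "\<forall>n\<ge>1. \<forall>i<n. \<forall>j<n.
        norm (A n $$ (i, j)) \<le> c\<^sub>1 * exp (- \<alpha> * d n i j) \<and>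
        norm (B n $$ (i, j)) \<le> c\<^sub>2 * exp (- \<alpha> * d n i j)"
    using assms(4) unfolding common_exp_decay_def by (elim exE conjE)
  obtain K where K: "\<And>n i. n \<ge> 1 \<Longrightarrow> i < n \<Longrightarrow> (\<Sum>j<n. exp (- \<alpha> * d n i j)) \<le> K"
    using exp_row_sums_bounded[OF pos(1) assms(5,3)] by blast
  \<comment> \<open>The sign of \<open>K\<close> follows from any single instance of the bound.\<close>
  have "0 \<le> (\<Sum>j<1. exp (- \<alpha> * d 1 0 j))"
    by (intro sum_nonneg) simp
  also have "\<dots> \<le> K"
    by (intro K) auto
  finally have "K \<ge> 0" .
  have rows: "(\<Sum>j<n. norm (M $$ (i, j))) \<le> c * K"
    if "n \<ge> 1" "i < n" "c > 0" "\<And>j. j < n \<Longrightarrow> norm (M $$ (i, j)) \<le> c * exp (- \<alpha> * d n i j)"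
    for M :: "'a mat" and n i c
  proof -
    have "(\<Sum>j<n. norm (M $$ (i, j))) \<le> (\<Sum>j<n. c * exp (- \<alpha> * d n i j))"
      using that(4) by (intro sum_mono) auto
    also have "\<dots> \<le> c * K"
      using K[OF that(1,2)] that(3) by (simp flip: sum_distrib_left)
    finally show ?thesis .
  qed
  have bound: "frob_norm (spamm_error (A n) (B n) \<tau>) \<le> c\<^sub>1 * K * (c\<^sub>2 * K) * sqrt (real n)"
    if "n \<ge> 1" for n
  proof (rule frob_norm_le_of_row_sums)
    show "spamm_error (A n) (B n) \<tau> \<in> carrier_mat n n"
      using assms that by (intro spamm_error_carrier) auto
    show "0 \<le> c\<^sub>1 * K * (c\<^sub>2 * K)"
      using pos \<open>K \<ge> 0\<close> by simp
    fix i assume "i < n"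
    have "(\<Sum>j<n. norm (spamm_error (A n) (B n) \<tau> $$ (i, j)))
        \<le> (\<Sum>j<n. \<Sum>l<n. norm (A n $$ (i, l)) * norm (B n $$ (l, j)))"
      using assms \<open>\<tau> > 0\<close> \<open>i < n\<close> that by (intro sum_mono spamm_error_entry_bounds(2)) auto
    also have "\<dots> \<le> c\<^sub>1 * K * (c\<^sub>2 * K)"
      using that pos \<open>K \<ge> 0\<close> \<open>i < n\<close> decay
      by (intro sum_norm_products_le_of_row_sums rows) auto
    finally show "(\<Sum>j<n. norm (spamm_error (A n) (B n) \<tau> $$ (i, j))) \<le> c\<^sub>1 * K * (c\<^sub>2 * K)" .
  qed
  show "(\<lambda>n. frob_norm (spamm_error (A n) (B n) \<tau>)) \<in> O[at_top](\<lambda>n. real n powr (1 / 2))"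
  proof (rule bigoI)
    show "\<forall>\<^sub>F n in at_top. norm (frob_norm (spamm_error (A n) (B n) \<tau>))
        \<le> c\<^sub>1 * K * (c\<^sub>2 * K) * norm (real n powr (1 / 2))"
      using eventually_ge_at_top[of 1]
      by eventually_elim
        (use bound in \<open>simp add: powr_half_sqrt frob_norm_eq_L2_set L2_set_nonneg\<close>)
  qed
next
  fix n :: nat and p :: real
  assume "n \<ge> 1" "p < 2"
  have "(\<lambda>\<tau>. frob_norm (spamm_error (A n) (B n) \<tau>)) \<in> O[at_right 0](\<lambda>\<tau>. \<tau>)"
    using assms \<open>n \<ge> 1\<close> by (intro frob_norm_spamm_error_bigo) auto
  also have "(\<lambda>\<tau>. \<tau>) \<in> O[at_right 0](\<lambda>\<tau>. \<tau> powr (p / 2))"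
    using \<open>p < 2\<close> by real_asymp
  finally show "(\<lambda>\<tau>. frob_norm (spamm_error (A n) (B n) \<tau>)) \<in> O[at_right 0](\<lambda>\<tau>. \<tau> powr (p / 2))" .
qed

end
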